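(* Let $\ell,n$ be positive integers and let $m_1\geq m_2\geq\dots\geq m_\ell$ be positive integers. Let $N=1+\sum_{i=1}^{r}(m_i-1)$, where $r=\min\left(\ell,\binom{n}{2}\right)$. Assume that either $n>2$, or $n=2$ and $N>2$. Then there exist idempotent operations $f_1,\dots,f_\ell$ on the set $[n]=\{1,\dots,n\}$, of arities $m_1,\dots,m_\ell$ respectively, such that the algebra $\mathbf{A}=([n];f_1,\dots,f_\ell)$ has a cube term of dimension $N$, but no cube term of dimension $N-1$.
   Context: For $\mathbf{a},\mathbf{b}\in A^d$ and $I\subseteq[d]=\{1,\dots,d\}$, let $\chi_I(\mathbf{a},\mathbf{b})\in A^d$ be the tuple whose $i$-th entry is $b_i$ if $i\in I$ and $a_i$ if $i\notin I$. An operation $f$ on $A$ is idempotent if $f(a,\dots,a)=a$ for all $a\in A$. Term operations of an algebra are the members of the clone generated by its basic operations. A cube term of dimension $d$ of an algebra $\mathbf{A}$ with universe $A$ is a $(2^d-1)$-ary term operation $t$ of $\mathbf{A}$, with arguments indexed by the nonempty subsets of $[d]$, such that $t(\chi_I(\mathbf{a},\mathbf{b})\colon \emptyset\neq I\subseteq[d])=\mathbf{a}$ for all $\mathbf{a},\mathbf{b}\in A^d$ ($t$ applied coordinatewise).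
   Formalization: The formal theorem additionally assumes N > 1; this excludes only the case n > 2 with all m_i = 1, where N = 1 and the claim is false, since a cube term of dimension 1 would be a unary t with t(b) = a for all a, b. *)

theory Defs
  imports Complex_Main "HOL-Library.FuncSet" "HOL-Library.NList"
begin

text \<open>
  A tuple in \<open>A\<^sup>k\<close> is a list in \<^term>\<open>nlists k A\<close>, so its entries are numbered
  \<open>0, \<dots>, k - 1\<close>.  Operations are extensional (\<^term>\<open>undefined\<close> off \<open>A\<^sup>k\<close>), so that
  equality of functions of a given arity is equality of operations on \<open>A\<close>.
\<close>

definition operations :: "'a set \<Rightarrow> nat \<Rightarrow> ('a list \<Rightarrow> 'a) set" where
  "operations A k = nlists k A \<rightarrow>\<^sub>E A"

definition idempotent_op :: "'a set \<Rightarrow> nat \<Rightarrow> ('a list \<Rightarrow> 'a) \<Rightarrow> bool" where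
  "idempotent_op A k f \<longleftrightarrow> (\<forall>a\<in>A. f (replicate k a) = a)"

text \<open>
  \<open>term_op A F k t\<close>: the \<open>k\<close>-ary operation \<open>t\<close> belongs to the clone on \<open>A\<close> generated by the
  set \<open>F\<close> of basic operations, each paired with its arity.
\<close>

inductive term_op :: "'a set \<Rightarrow> (nat \<times> ('a list \<Rightarrow> 'a)) set \<Rightarrow> nat \<Rightarrow> ('a list \<Rightarrow> 'a) \<Rightarrow> bool"
  for A F where
  proj: "i < k \<Longrightarrow> term_op A F k (\<lambda>xs\<in>nlists k A. xs ! i)"
| basic: "(k, f) \<in> F \<Longrightarrow> term_op A F k f"
| comp: "term_op A F (length gs) f \<Longrightarrow> \<forall>g\<in>set gs. term_op A F k g \<Longrightarrow>
    term_op A F k (\<lambda>xs\<in>nlists k A. f (map (\<lambda>g. g xs) gs))"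

definition chi :: "nat set \<Rightarrow> 'a list \<Rightarrow> 'a list \<Rightarrow> 'a list" where
  "chi I a b = map (\<lambda>i. if i \<in> I then b ! i else a ! i) [0..<length a]"

text \<open>
  Since coordinates are numbered from 0, the index set \<open>[d]\<close> becomes \<^term>\<open>{..<d}\<close>.  The list \<open>Is\<close>
  enumerates its nonempty subsets and thereby says which argument of \<open>t\<close> has which index;
  its length is \<open>2 ^ d - 1\<close>.
\<close>

definition is_cube_term ::
  "'a set \<Rightarrow> (nat \<times> ('a list \<Rightarrow> 'a)) set \<Rightarrow> nat \<Rightarrow> ('a list \<Rightarrow> 'a) \<Rightarrow> bool" where
  "is_cube_term A F d t \<longleftrightarrow> term_op A F (2 ^ d - 1) t \<and>
    (\<exists>Is. distinct Is \<and> set Is = {I. I \<subseteq> {..<d} \<and> I \<noteq> {}} \<and>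
      (\<forall>a\<in>nlists d A. \<forall>b\<in>nlists d A. \<forall>i<d. t (map (\<lambda>I. chi I a b ! i) Is) = a ! i))"

definition has_cube_term :: "'a set \<Rightarrow> (nat \<times> ('a list \<Rightarrow> 'a)) set \<Rightarrow> nat \<Rightarrow> bool" where
  "has_cube_term A F d \<longleftrightarrow> (\<exists>t. is_cube_term A F d t)"

text \<open>
  A cube term of dimension 1 would be a unary \<open>t\<close> with \<open>t b = a\<close> for all \<open>a\<close> and \<open>b\<close>.
  This is why a cube term of dimension \<open>N\<close> can only be asked for when \<open>N > 1\<close>.
\<close>

lemma no_cube_term_of_dimension_1:
  assumes "x \<in> A" "y \<in> A" "x \<noteq> y"
  shows "\<not> has_cube_term A F 1"
proof
  assume "has_cube_term A F 1"
  then obtain t Is where Is: "set Is = {I. I \<subseteq> {..<1::nat} \<and> I \<noteq> {}}"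
    and t: "\<forall>a\<in>nlists 1 A. \<forall>b\<in>nlists 1 A. \<forall>i<1. t (map (\<lambda>I. chi I a b ! i) Is) = a ! i"
    unfolding has_cube_term_def is_cube_term_def by (elim exE conjE) (rule that)
  have x: "[x] \<in> nlists 1 A" and y: "[y] \<in> nlists 1 A"
    by (rule nlistsI; use assms(1,2) in simp)+
  have "chi I [x] [x] ! 0 = chi I [y] [x] ! 0" if "I \<in> set Is" for I
  proof -
    have "I \<subseteq> {..<1}" "I \<noteq> {}"
      using that unfolding Is by blast+
    then have "0 \<in> I"
      by fastforce
    then show ?thesis
      by (simp add: chi_def)
  qed
  then have eq: "map (\<lambda>I. chi I [x] [x] ! 0) Is = map (\<lambda>I. chi I [y] [x] ! 0) Is"
    by (rule map_cong[OF refl])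
  have "x = t (map (\<lambda>I. chi I [x] [x] ! 0) Is)"
    using t[rule_format, OF x x, of 0] by (metis less_one nth_Cons_0)
  also have "\<dots> = y"
    unfolding eq using t[rule_format, OF y x, of 0] by (metis less_one nth_Cons_0)
  finally show False
    using assms(3) by contradiction
qed

end

theory Submission
  imports Defs "HOL-Combinatorics.Cycles"
begin

text \<open>
  Let \<open>N > 2\<close>.  Colour the two-element subsets of \<open>[n]\<close> with the indices \<open>i \<le> r\<close> such that
  \<open>m\<^sub>i \<ge> 2\<close>, using every colour.  On tuples over a pair \<open>a < b\<close> of colour \<open>i\<close>, let \<open>f\<^sub>i\<close> return
  \<open>a\<close> iff at least two entries are \<open>a\<close>, and let all other operations be minima.
  Choose one pair \<open>{a, b}\<close> of each colour \<open>i\<close> and repeat it \<open>m\<^sub>i - 1\<close> times: the tuples over these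
  \<open>N - 1\<close> pairs with some entry \<open>a\<close> form an invariant relation, which excludes a cube term of
  dimension \<open>N - 1\<close>.  On the other hand every pair is a subuniverse and the identities of
  a cube term involve only two elements at a time, so it suffices to find an \<open>N\<close>-ary near
  unanimity term; this is built one colour at a time, each colour costing \<open>m\<^sub>i - 1\<close> variables.

  If \<open>N = 2\<close>, then \<open>n \<ge> 3\<close> and some \<open>m\<^sub>i\<close> is \<open>2\<close>; let \<open>f\<^sub>i\<close> be an idempotent quasigroup, which has a
  Maltsev term.
\<close>

section \<open>Term operations\<close>

text \<open>As simp rules these two loop with \<open>nlists_iff\<close>.\<close>

declare nlistsE_length [simp del] nlistsE_set [simp del]

lemma nlists_iff: "xs \<in> nlists k A \<longleftrightarrow> length xs = k \<and> set xs \<subseteq> A"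
  unfolding nlists_def by simp

text \<open>Equivalently, every subset of \<open>A\<close> is a subuniverse. This allows near
  unanimity to be checked on two elements at a time.\<close>

definition conservative :: "'a set \<Rightarrow> (nat \<times> ('a list \<Rightarrow> 'a)) set \<Rightarrow> bool" where
  "conservative A F \<longleftrightarrow> (\<forall>(k, f)\<in>F. \<forall>z\<in>nlists k A. f z \<in> set z)"

lemma term_op_conservative:
  assumes "term_op A F k t"
    and F: "conservative A F"
    and "z \<in> nlists k A"
  shows "t z \<in> set z"
  using assms(1,3)
proof (induction arbitrary: z)
  case (proj i k)
  then show ?case
    by (auto simp: nlists_iff)
next
  case (basic k f)
  then show ?case
    using F unfolding conservative_def by blast
next
  case (comp gs f k)
  have sub: "set (map (\<lambda>g. g z) gs) \<subseteq> set z"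
    using comp.IH(2) comp.prems by auto
  then have "map (\<lambda>g. g z) gs \<in> nlists (length gs) A"
    using comp.prems by (auto simp: nlists_iff)
  then have "f (map (\<lambda>g. g z) gs) \<in> set (map (\<lambda>g. g z) gs)"
    by (rule comp.IH(1))
  then show ?case
    using sub comp.prems by auto
qed

text \<open>When \<open>a j \<noteq> b j\<close> for all \<open>j < d\<close>, this is the box of
  the pairs \<open>{a j, b j}\<close> with the single tuple \<open>b\<close> removed. Tuples are
  functions on \<open>nat\<close> of which only the values below \<open>d\<close> count.\<close>

definition cross :: "nat \<Rightarrow> (nat \<Rightarrow> 'a) \<Rightarrow> (nat \<Rightarrow> 'a) \<Rightarrow> (nat \<Rightarrow> 'a) \<Rightarrow> bool" where
  "cross d a b x \<longleftrightarrow> (\<forall>j<d. x j = a j \<or> x j = b j) \<and> (\<exists>j<d. x j = a j)"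

lemma cross_cong: "(\<And>j. j < d \<Longrightarrow> x j = y j) \<Longrightarrow> cross d a b x \<longleftrightarrow> cross d a b y"
  by (auto simp: cross_def)

text \<open>\<open>X p\<close> is the tuple in argument \<open>p\<close>, and \<open>t\<close> acts
  on the columns. Under composition the inner terms produce tuples of the relation, to which the
  outer term is then applied.\<close>

lemma term_op_preserves_cross:
  assumes "term_op A F k t"
    and A: "\<And>j. j < d \<Longrightarrow> a j \<in> A" "\<And>j. j < d \<Longrightarrow> b j \<in> A"
    and F: "\<And>k f X. (k, f) \<in> F \<Longrightarrow> (\<And>p. p < k \<Longrightarrow> cross d a b (X p)) \<Longrightarrow>
      cross d a b (\<lambda>j. f (map (\<lambda>p. X p j) [0..<k]))"
    and "\<And>p. p < k \<Longrightarrow> cross d a b (X p)"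
  shows "cross d a b (\<lambda>j. t (map (\<lambda>p. X p j) [0..<k]))"
proof -
  \<comment> \<open>Columns must be tuples over \<open>A\<close>, because operations are
    \<open>undefined\<close> elsewhere.\<close>
  have mem: "map (\<lambda>p. X p j) [0..<k] \<in> nlists k A"
    if "\<And>p. p < k \<Longrightarrow> cross d a b (X p)" "j < d" for k j and X :: "nat \<Rightarrow> nat \<Rightarrow> 'a"
    using that A by (fastforce simp: nlists_iff cross_def)
  show ?thesis
    using assms(1) assms(5)
  proof (induction arbitrary: X)
    case (proj i k)
    have "cross d a b (X i)"
      using proj by blast
    then show ?case
      using mem[OF proj.prems] \<open>i < k\<close> by (subst cross_cong[of d _ "X i"]) auto
  next
    case (basic k f)
    then show ?case
      using F by blast
  next
    case (comp gs f k)
    define Y where "Y p j = (gs ! p) (map (\<lambda>q. X q j) [0..<k])" for p j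
    have "cross d a b (Y p)" if "p < length gs" for p
      unfolding Y_def using comp.IH(2) comp.prems nth_mem[OF that] by blast
    then have "cross d a b (\<lambda>j. f (map (\<lambda>p. Y p j) [0..<length gs]))"
      by (rule comp.IH(1))
    moreover have "map (\<lambda>p. Y p j) [0..<length gs] = map (\<lambda>g. g (map (\<lambda>q. X q j) [0..<k])) gs" for j
      by (rule nth_equalityI) (auto simp: Y_def)
    ultimately show ?case
      using mem[OF comp.prems] by (subst cross_cong) auto
  qed
qed

text \<open>For nonempty \<open>I\<close> the tuple \<open>chi I b a\<close> agrees with
  \<open>a\<close> somewhere, so it lies in the relation. A cube term would send all these tuples to
  \<open>b\<close>, the one tuple that was removed.\<close>

lemma no_cube_term_if_cross:
  assumes A: "\<And>j. j < d \<Longrightarrow> a j \<in> A" "\<And>j. j < d \<Longrightarrow> b j \<in> A" "\<And>j. j < d \<Longrightarrow> a j \<noteq> b j"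
    and F: "\<And>k f X. (k, f) \<in> F \<Longrightarrow> (\<And>p. p < k \<Longrightarrow> cross d a b (X p)) \<Longrightarrow>
      cross d a b (\<lambda>j. f (map (\<lambda>p. X p j) [0..<k]))"
  shows "\<not> has_cube_term A F d"
proof
  assume "has_cube_term A F d"
  then obtain t Is where t: "term_op A F (2 ^ d - 1) t" and dist: "distinct Is"
    and Is: "set Is = {I. I \<subseteq> {..<d} \<and> I \<noteq> {}}"
    and cube: "\<forall>a\<in>nlists d A. \<forall>b\<in>nlists d A. \<forall>i<d. t (map (\<lambda>I. chi I a b ! i) Is) = a ! i"
    unfolding has_cube_term_def is_cube_term_def by (elim exE conjE) (rule that)
  have "set Is = Pow {..<d} - {{}}"
    unfolding Is by auto
  then have len: "length Is = 2 ^ d - 1"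
    using distinct_card[OF dist] by (simp add: card_Pow)
  define X where "X p j = (if j \<in> Is ! p then a j else b j)" for p j
  have X: "cross d a b (X p)" if "p < 2 ^ d - 1" for p
  proof -
    have "Is ! p \<subseteq> {..<d}" "Is ! p \<noteq> {}"
      using nth_mem[of p Is] that len Is by auto
    then obtain j where "j \<in> Is ! p" "j < d"
      by blast
    then show ?thesis
      unfolding cross_def X_def by auto
  qed
  have "cross d a b (\<lambda>j. t (map (\<lambda>p. X p j) [0..<2 ^ d - 1]))"
    using t A(1,2) F X by (rule term_op_preserves_cross)
  then obtain j where j: "j < d" "t (map (\<lambda>p. X p j) [0..<2 ^ d - 1]) = a j"
    by (auto simp: cross_def)
  \<comment> \<open>The cube identity is used with \<open>a\<close> and \<open>b\<close>
    exchanged.\<close>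
  have "t (map (\<lambda>I. chi I (map b [0..<d]) (map a [0..<d]) ! j) Is) = map b [0..<d] ! j"
    using A j(1) by (intro cube[rule_format]) (auto simp: nlists_iff)
  moreover have "map (\<lambda>I. chi I (map b [0..<d]) (map a [0..<d]) ! j) Is
      = map (\<lambda>p. X p j) [0..<2 ^ d - 1]"
    using len j(1) by (intro nth_equalityI) (auto simp: chi_def X_def)
  ultimately show False
    using j A(3)[of j] by simp
qed

section \<open>Near unanimity terms\<close>

text \<open>The positions at which a near unanimity identity fails; \<open>t\<close> is a near
  unanimity operation iff all these sets are empty. Terms are improved below by shrinking
  them.\<close>

definition deviations :: "nat \<Rightarrow> ('a list \<Rightarrow> 'a) \<Rightarrow> 'a \<Rightarrow> 'a \<Rightarrow> nat set" where
  "deviations N t x y = {j. j < N \<and> t ((replicate N x)[j := y]) \<noteq> x}"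

lemma deviations_same: "t (replicate N x) = x \<Longrightarrow> deviations N t x x = {}"
  by (simp add: deviations_def list_update_same_conv[THEN iffD2])

text \<open>Only the arguments indexed by singletons are kept: at coordinate \<open>i\<close>,
  argument \<open>{j}\<close> is \<open>a ! i\<close> unless \<open>j = i\<close>, which is the near
  unanimity pattern.\<close>

lemma near_unanimity_imp_cube_term:
  assumes t: "term_op A F N t"
    and dev: "\<And>x y. x \<in> A \<Longrightarrow> y \<in> A \<Longrightarrow> deviations N t x y = {}"
  shows "has_cube_term A F N"
proof -
  have "finite {I. I \<subseteq> {..<N} \<and> I \<noteq> {}}"
    by simp
  then obtain Is where Is: "set Is = {I. I \<subseteq> {..<N} \<and> I \<noteq> {}}" and dist: "distinct Is"
    using finite_distinct_list by metis
  have "set Is = Pow {..<N} - {{}}"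
    unfolding Is by auto
  then have len: "length Is = 2 ^ N - 1"
    using distinct_card[OF dist] by (simp add: card_Pow)
  have "\<exists>p<length Is. Is ! p = {j}" if "j < N" for j
  proof -
    have "{j} \<in> set Is"
      unfolding Is using that by auto
    then show ?thesis
      unfolding in_set_conv_nth .
  qed
  then obtain pos where pos: "\<And>j. j < N \<Longrightarrow> pos j < length Is \<and> Is ! pos j = {j}"
    by metis
  define gs where "gs = map (\<lambda>j. \<lambda>xs\<in>nlists (2 ^ N - 1) A. xs ! pos j) [0..<N]"
  define t' where "t' = (\<lambda>xs\<in>nlists (2 ^ N - 1) A. t (map (\<lambda>g. g xs) gs))"
  have "term_op A F (2 ^ N - 1) t'"
    unfolding t'_def
  proof (rule term_op.comp)
    show "term_op A F (length gs) t"
      using t by (simp add: gs_def)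
    show "\<forall>g\<in>set gs. term_op A F (2 ^ N - 1) g"
      using pos len by (auto simp: gs_def intro!: term_op.proj)
  qed
  moreover have "t' (map (\<lambda>I. chi I a b ! i) Is) = a ! i"
    if a: "a \<in> nlists N A" and b: "b \<in> nlists N A" and i: "i < N" for a b i
  proof -
    let ?xs = "map (\<lambda>I. chi I a b ! i) Is"
    have [simp]: "length a = N"
      using a by (simp add: nlists_iff)
    have mem: "a ! i \<in> A" "b ! i \<in> A"
      using a b i by (auto simp: nlists_iff)
    then have xs: "?xs \<in> nlists (2 ^ N - 1) A"
      using i len by (auto simp: nlists_iff chi_def)
    have "map (\<lambda>g. g ?xs) gs = (replicate N (a ! i))[i := b ! i]"
      using xs pos i by (intro nth_equalityI) (auto simp: gs_def chi_def nth_list_update)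
    then have "t' ?xs = t ((replicate N (a ! i))[i := b ! i])"
      using xs by (simp add: t'_def)
    then show ?thesis
      using dev[OF mem] i by (auto simp: deviations_def)
  qed
  ultimately show ?thesis
    unfolding has_cube_term_def is_cube_term_def using dist Is by blast
qed

section \<open>Threshold operations\<close>

definition twice :: "'a \<Rightarrow> 'a list \<Rightarrow> bool" where
  "twice a z \<longleftrightarrow> (\<exists>p q. p < q \<and> q < length z \<and> z ! p = a \<and> z ! q = a)"

text \<open>On pairs of colour \<open>i\<close> this is the maximum for \<open>k = 2\<close> and the
  majority operation for \<open>k = 3\<close>.\<close>

definition threshold_op ::
  "'a::linorder set \<Rightarrow> ('a set \<Rightarrow> 'c) \<Rightarrow> nat \<Rightarrow> 'c \<Rightarrow> 'a list \<Rightarrow> 'a" where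
  "threshold_op A c k i = (\<lambda>z\<in>nlists k A.
    if card (set z) = 2 \<and> c (set z) = i \<and> \<not> twice (Min (set z)) z
    then Max (set z) else Min (set z))"

lemma threshold_op_mem:
  assumes "z \<in> nlists k A" "k \<ge> 1"
  shows "threshold_op A c k i z \<in> set z"
proof -
  have "set z \<noteq> {}"
    using assms by (auto simp: nlists_iff)
  then show ?thesis
    using assms(1) by (simp add: threshold_op_def)
qed

lemma set_pair_cases:
  assumes "set z \<subseteq> {a, b}" "z \<noteq> []"
  obtains "set z = {a}" | "set z = {b}" | "set z = {a, b}"
  using assms by (cases z) auto

lemma threshold_op_other:
  assumes z: "z \<in> nlists k A" "set z \<subseteq> {a, b}" and "k \<ge> 1" and ab: "a < b" and c: "c {a, b} \<noteq> i"
  shows "threshold_op A c k i z = a \<longleftrightarrow> a \<in> set z"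
proof -
  have "z \<noteq> []"
    using assms by (auto simp: nlists_iff)
  with z(2) show ?thesis
    by (cases rule: set_pair_cases) (use z(1) ab c in \<open>auto simp: threshold_op_def min_def\<close>)
qed

lemma twiceI: "p < q \<Longrightarrow> q < length z \<Longrightarrow> z ! p = a \<Longrightarrow> z ! q = a \<Longrightarrow> twice a z"
  unfolding twice_def by blast

lemma twice_if_constant:
  assumes "set z = {a}" "length z \<ge> 2"
  shows "twice a z"
proof -
  have "z ! 0 \<in> set z" "z ! 1 \<in> set z"
    using assms(2) by (auto intro!: nth_mem)
  then have "z ! 0 = a" "z ! 1 = a"
    using assms(1) by auto
  then show ?thesis
    using assms(2) by (intro twiceI[of 0 1]) auto
qed

lemma twice_imp_mem: "twice a z \<Longrightarrow> a \<in> set z"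
  by (auto simp: twice_def)

text \<open>The constant tuple \<open>a\<close> fails the cardinality test and yields the minimum
  \<open>a\<close>; this agrees with \<open>twice\<close> because \<open>k \<ge> 2\<close>.\<close>

lemma threshold_op_own:
  assumes z: "z \<in> nlists k A" "set z \<subseteq> {a, b}" and k: "k \<ge> 2" and ab: "a < b" and c: "c {a, b} = i"
  shows "threshold_op A c k i z = a \<longleftrightarrow> twice a z"
proof -
  have len: "length z = k"
    using z by (simp add: nlists_iff)
  then have "z \<noteq> []"
    using k by auto
  with z(2) show ?thesis
  proof (cases rule: set_pair_cases)
    case 1
    then show ?thesis
      using z(1) twice_if_constant[of z a] len k by (simp add: threshold_op_def)
  next
    case 2
    then show ?thesis
      using z(1) ab twice_imp_mem[of a z] by (auto simp: threshold_op_def)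
  next
    case 3
    then show ?thesis
      using z(1) ab c by (auto simp: threshold_op_def min_def max_def)
  qed
qed

section \<open>Composition and deviations\<close>

definition compose_op :: "'a set \<Rightarrow> nat \<Rightarrow> ('a list \<Rightarrow> 'a) \<Rightarrow> ('a list \<Rightarrow> 'a) list \<Rightarrow> 'a list \<Rightarrow> 'a" where
  "compose_op A N f gs = (\<lambda>xs\<in>nlists N A. f (map (\<lambda>g. g xs) gs))"

context
  fixes A :: "'a::linorder set" and c :: "'a set \<Rightarrow> 'c" and N k :: nat and i :: 'c
    and gs :: "('a list \<Rightarrow> 'a) list" and a b :: 'a
  assumes len: "length gs = k" and ab: "a < b" "a \<in> A" "b \<in> A"
    and conservative: "\<forall>g\<in>set gs. \<forall>z\<in>nlists N A. g z \<in> set z"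
begin

private abbreviation "point x y j \<equiv> (replicate N x)[j := y]"
private abbreviation "t \<equiv> compose_op A N (threshold_op A c k i) gs"

text \<open>Conservative inner operations keep all intermediate values in \<open>{a, b}\<close>, so
  the outer operation sees only which of them deviate.\<close>

private lemma args:
  assumes "j < N" "(x, y) = (a, b) \<or> (x, y) = (b, a)"
  shows "point x y j \<in> nlists N A"
    and "map (\<lambda>g. g (point x y j)) gs \<in> nlists k A"
    and "set (map (\<lambda>g. g (point x y j)) gs) \<subseteq> {a, b}"
    and "t (point x y j) = threshold_op A c k i (map (\<lambda>g. g (point x y j)) gs)"
proof -
  have sub: "set (point x y j) \<subseteq> {a, b}"
    using assms set_update_subset_insert[of "replicate N x" j y] by (auto split: if_splits)
  then show p: "point x y j \<in> nlists N A"
    using ab by (auto simp: nlists_iff)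
  show s: "set (map (\<lambda>g. g (point x y j)) gs) \<subseteq> {a, b}"
    using conservative[rule_format, OF _ p] sub by auto
  then show "map (\<lambda>g. g (point x y j)) gs \<in> nlists k A"
    using len ab by (auto simp: nlists_iff)
  show "t (point x y j) = threshold_op A c k i (map (\<lambda>g. g (point x y j)) gs)"
    using p by (simp add: compose_op_def)
qed

text \<open>The outer operation is a minimum here, so \<open>t\<close> leaves \<open>b\<close> as
  soon as one inner term does.\<close>

lemma deviations_other_ba:
  assumes "c {a, b} \<noteq> i" "k \<ge> 1"
  shows "deviations N t b a \<subseteq> (\<Union>g\<in>set gs. deviations N g b a)"
proof
  fix j assume "j \<in> deviations N t b a"
  then have j: "j < N" and ne: "t (point b a j) \<noteq> b"
    by (auto simp: deviations_def)
  note args = args[OF j, of b a, OF disjI2[OF refl]]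
  have "threshold_op A c k i (map (\<lambda>g. g (point b a j)) gs) \<in> {a, b}"
    using threshold_op_mem[OF args(2) assms(2), of c i] args(3) by auto
  then have "a \<in> set (map (\<lambda>g. g (point b a j)) gs)"
    using threshold_op_other[OF args(2,3) assms(2) ab(1), where c = c, OF assms(1)] args(4) ne by auto
  then obtain g where g: "g \<in> set gs" "g (point b a j) = a"
    by auto
  then have "j \<in> deviations N g b a"
    using j ab by (simp add: deviations_def)
  then show "j \<in> (\<Union>g\<in>set gs. deviations N g b a)"
    using g(1) by blast
qed

text \<open>A minimum leaves \<open>a\<close> only if every inner term does: deviation sets get
  intersected.\<close>

lemma deviations_other_ab:
  assumes "c {a, b} \<noteq> i" "k \<ge> 1" "g \<in> set gs"
  shows "deviations N t a b \<subseteq> deviations N g a b"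
proof
  fix j assume "j \<in> deviations N t a b"
  then have j: "j < N" and ne: "t (point a b j) \<noteq> a"
    by (auto simp: deviations_def)
  note args = args[OF j, of a b, OF disjI1[OF refl]]
  have "a \<notin> set (map (\<lambda>g. g (point a b j)) gs)"
    using threshold_op_other[OF args(2,3) assms(2) ab(1), where c = c, OF assms(1)] args(4) ne by auto
  moreover have "g (point a b j) \<in> set (map (\<lambda>g. g (point a b j)) gs)"
    unfolding set_map using assms(3) by (intro image_eqI[of _ _ g]) auto
  ultimately have "g (point a b j) \<noteq> a"
    by metis
  then show "j \<in> deviations N g a b"
    using j by (simp add: deviations_def)
qed

text \<open>The threshold is 2, so two inner terms have to leave \<open>b\<close> at the same
  position.\<close>

lemma deviations_own_ba:
  assumes "c {a, b} = i" "k \<ge> 2" "j \<in> deviations N t b a"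
  obtains p q where "p < q" "q < k" "j \<in> deviations N (gs ! p) b a" "j \<in> deviations N (gs ! q) b a"
proof -
  have j: "j < N" and ne: "t (point b a j) \<noteq> b"
    using assms(3) by (auto simp: deviations_def)
  note args = args[OF j, of b a, OF disjI2[OF refl]]
  have "threshold_op A c k i (map (\<lambda>g. g (point b a j)) gs) \<in> {a, b}"
    using threshold_op_mem[OF args(2), of c i] assms(2) args(3) by auto
  then have "twice a (map (\<lambda>g. g (point b a j)) gs)"
    using threshold_op_own[OF args(2,3) assms(2) ab(1), where c = c, OF assms(1)] args(4) ne by auto
  then obtain p q where "p < q" "q < k" "(gs ! p) (point b a j) = a" "(gs ! q) (point b a j) = a"
    using len by (auto simp: twice_def)
  then show thesis
    using j ab by (intro that[of p q]) (auto simp: deviations_def)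
qed

text \<open>If \<open>t\<close> leaves \<open>a\<close>, at most one inner term still returns
  \<open>a\<close>, so any two inner terms include a deviating one.\<close>

lemma deviations_own_ab:
  assumes "c {a, b} = i" "k \<ge> 2" "j \<in> deviations N t a b" "p < q" "q < k"
  shows "j \<in> deviations N (gs ! p) a b \<or> j \<in> deviations N (gs ! q) a b"
proof -
  have j: "j < N" and ne: "t (point a b j) \<noteq> a"
    using assms(3) by (auto simp: deviations_def)
  note args = args[OF j, of a b, OF disjI1[OF refl]]
  have "\<not> twice a (map (\<lambda>g. g (point a b j)) gs)"
    using threshold_op_own[OF args(2,3) assms(2) ab(1), where c = c, OF assms(1)] args(4) ne by auto
  then have "(gs ! p) (point a b j) \<noteq> a \<or> (gs ! q) (point a b j) \<noteq> a"
    using len assms(4,5) twiceI[of p q "map (\<lambda>g. g (point a b j)) gs" a] by auto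
  then show ?thesis
    using j by (auto simp: deviations_def)
qed

end


text \<open>
  \<open>S\<close> is the set of colours already treated.  Only the sets \<open>deviations N t b a\<close> obstruct an
  untreated colour, but the threshold operation that empties them may enlarge
  \<open>deviations N t a b\<close> if its arity is 2.
\<close>

definition staged ::
  "'a::linorder set \<Rightarrow> (nat \<times> ('a list \<Rightarrow> 'a)) set \<Rightarrow> ('a set \<Rightarrow> 'c) \<Rightarrow> nat \<Rightarrow>
    'c set \<Rightarrow> ('c \<Rightarrow> nat set) \<Rightarrow> ('a list \<Rightarrow> 'a) \<Rightarrow> bool" where
  "staged A F c N S \<beta> t \<longleftrightarrow> term_op A F N t \<and> (\<forall>a\<in>A. \<forall>b\<in>A. a < b \<longrightarrow>
    (if c {a, b} \<in> S
     then deviations N t b a = {} \<and> deviations N t a b \<subseteq> \<beta> (c {a, b})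
     else deviations N t b a \<subseteq> \<beta> (c {a, b}) \<and> deviations N t a b = {}))"

lemma stagedD:
  assumes "staged A F c N S \<beta> t"
  shows "term_op A F N t"
    and "a \<in> A \<Longrightarrow> b \<in> A \<Longrightarrow> a < b \<Longrightarrow> c {a, b} \<in> S \<Longrightarrow>
      deviations N t b a = {} \<and> deviations N t a b \<subseteq> \<beta> (c {a, b})"
    and "a \<in> A \<Longrightarrow> b \<in> A \<Longrightarrow> a < b \<Longrightarrow> c {a, b} \<notin> S \<Longrightarrow>
      deviations N t b a \<subseteq> \<beta> (c {a, b}) \<and> deviations N t a b = {}"
  using assms unfolding staged_def by meson+

lemma stagedI:
  assumes "term_op A F N t"
    and "\<And>a b. a \<in> A \<Longrightarrow> b \<in> A \<Longrightarrow> a < b \<Longrightarrow> c {a, b} \<in> S \<Longrightarrow>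
      deviations N t b a = {} \<and> deviations N t a b \<subseteq> \<beta> (c {a, b})"
    and "\<And>a b. a \<in> A \<Longrightarrow> b \<in> A \<Longrightarrow> a < b \<Longrightarrow> c {a, b} \<notin> S \<Longrightarrow>
      deviations N t b a \<subseteq> \<beta> (c {a, b}) \<and> deviations N t a b = {}"
  shows "staged A F c N S \<beta> t"
  using assms unfolding staged_def by simp

lemma staged_mono: "staged A F c N S \<beta> t \<Longrightarrow> (\<And>j. \<beta> j \<subseteq> \<gamma> j) \<Longrightarrow> staged A F c N S \<gamma> t"
  unfolding staged_def by (meson subset_trans)

lemma deviations_proj:
  assumes "p < N" "x \<in> A" "y \<in> A" "x \<noteq> y"
  shows "deviations N (\<lambda>xs\<in>nlists N A. xs ! p) x y = {p}"
proof -
  have "(replicate N x)[j := y] \<in> nlists N A" for j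
    using assms set_update_subset_insert[of "replicate N x" j y]
    by (auto simp: nlists_iff split: if_splits)
  then show ?thesis
    using assms by (auto simp: deviations_def nth_list_update split: if_splits)
qed

section \<open>Building a near unanimity term one colour at a time\<close>

context
  fixes A :: "'a::linorder set" and F :: "(nat \<times> ('a list \<Rightarrow> 'a)) set"
    and c :: "'a set \<Rightarrow> 'c" and N :: nat
  assumes conservative: "conservative A F"
begin

text \<open>The operation is applied to the projections to the \<open>k\<close> variables in
  \<open>X\<close>. Their deviation sets are disjoint singletons, so pairwise intersections vanish
  and unions stay in \<open>X\<close>.\<close>

lemma staged_singleton:
  assumes k: "(k, threshold_op A c k i) \<in> F" "k \<ge> 2" and X: "X \<subseteq> {..<N}" "card X = k"
  shows "\<exists>t. staged A F c N {i} (\<lambda>j. if j = i \<and> k \<ge> 3 then {} else X) t"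
proof -
  have "finite X"
    using X(1) finite_subset by blast
  then obtain qs where qs: "set qs = X" "distinct qs"
    using finite_distinct_list by blast
  then have len: "length qs = k"
    using distinct_card[OF qs(2)] qs(1) X(2) by simp
  define gs where "gs = map (\<lambda>p. \<lambda>xs\<in>nlists N A. xs ! p) qs"
  have lgs: "length gs = k"
    using len by (simp add: gs_def)
  have terms: "term_op A F N g" if "g \<in> set gs" for g
    using that qs X by (auto simp: gs_def intro!: term_op.proj)
  have cons: "\<forall>g\<in>set gs. \<forall>z\<in>nlists N A. g z \<in> set z"
    using term_op_conservative[OF _ conservative] terms by blast
  let ?t = "compose_op A N (threshold_op A c k i) gs"
  have dev: "deviations N (gs ! p) x y = {qs ! p}" if "p < k" "x \<in> A" "y \<in> A" "x \<noteq> y" for p x y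
  proof -
    have "qs ! p < N"
      using nth_mem[of p qs] that(1) len qs(1) X(1) by auto
    then show ?thesis
      using deviations_proj[OF _ that(2-4)] that(1) len by (simp add: gs_def)
  qed
  have devX: "deviations N g x y \<subseteq> X" if g: "g \<in> set gs" and "x \<in> A" "y \<in> A" "x \<noteq> y" for g x y
  proof -
    obtain p where "p < k" "g = gs ! p"
      using g lgs by (metis in_set_conv_nth)
    then show ?thesis
      using dev[OF _ that(2-4)] qs(1) len by (metis nth_mem singletonD subsetI)
  qed
  have disj: "\<not> (j \<in> deviations N (gs ! p) x y \<and> j \<in> deviations N (gs ! q) x y)"
    if "p < q" "q < k" "x \<in> A" "y \<in> A" "x \<noteq> y" for j p q x y
    using that dev qs(2) len by (simp add: nth_eq_iff_index_eq)
  have "term_op A F N ?t"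
    unfolding compose_op_def
    by (rule term_op.comp) (use terms term_op.basic[OF k(1)] lgs in auto)
  moreover have "if c {a, b} \<in> {i}
     then deviations N ?t b a = {} \<and>
       deviations N ?t a b \<subseteq> (if c {a, b} = i \<and> k \<ge> 3 then {} else X)
     else deviations N ?t b a \<subseteq> (if c {a, b} = i \<and> k \<ge> 3 then {} else X) \<and>
       deviations N ?t a b = {}"
    if ab: "a \<in> A" "b \<in> A" "a < b" for a b
  proof (cases "c {a, b} = i")
    case True
    have "deviations N ?t b a = {}"
      using deviations_own_ba[OF lgs ab(3,1,2) cons, where c = c, OF True k(2)] disj[of _ _ b a] ab
      by (metis all_not_in_conv less_irrefl)
    moreover have own: "j \<in> deviations N (gs ! p) a b \<or> j \<in> deviations N (gs ! q) a b"
      if "j \<in> deviations N ?t a b" "p < q" "q < k" for j p q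
      using deviations_own_ab[OF lgs ab(3,1,2) cons, where c = c, OF True k(2) that] by blast
    have "deviations N ?t a b \<subseteq> X"
    proof
      fix j assume "j \<in> deviations N ?t a b"
      then have "j \<in> deviations N (gs ! 0) a b \<or> j \<in> deviations N (gs ! 1) a b"
        using k(2) by (intro own) auto
      then show "j \<in> X"
        using devX[OF nth_mem, of 0 a b] devX[OF nth_mem, of 1 a b] lgs k(2) ab by auto
    qed
    moreover have "deviations N ?t a b = {}" if "k \<ge> 3"
    proof (rule ccontr)
      assume "deviations N ?t a b \<noteq> {}"
      then obtain j where j: "j \<in> deviations N ?t a b"
        by blast
      show False
        \<comment> \<open>Of three projections two would deviate at \<open>j\<close>, but their
          deviation sets are disjoint.\<close>
        using own[OF j, of 0 1] own[OF j, of 0 2] own[OF j, of 1 2]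
          disj[of 0 1 a b j] disj[of 0 2 a b j] disj[of 1 2 a b j] that ab by auto
    qed
    ultimately show ?thesis
      using True by simp
  next
    case False
    have ne: "k \<ge> 1"
      using k(2) by simp
    have "deviations N ?t b a \<subseteq> (\<Union>g\<in>set gs. deviations N g b a)"
      using deviations_other_ba[OF lgs ab(3,1,2) cons, where c = c, OF False ne] by blast
    also have "\<dots> \<subseteq> X"
      using devX ab by blast
    finally have "deviations N ?t b a \<subseteq> X" .
    moreover have "deviations N ?t a b \<subseteq> deviations N (gs ! p) a b" if "p < k" for p
      using deviations_other_ab[OF lgs ab(3,1,2) cons, where c = c, OF False ne] that lgs by auto
    from this[of 0] this[of 1] have "deviations N ?t a b = {}"
      using disj[of 0 1 a b] k(2) ab by auto
    ultimately show ?thesis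
      using False by simp
  qed
  ultimately show ?thesis
    unfolding staged_def by blast
qed

text \<open>
  Let \<open>i\<close> be a new colour.  The deviation set \<open>C\<close> of the colours in \<open>insert i S\<close> is shrunk one
  element at a time: the operation of colour \<open>i\<close> is applied to terms whose sets are
  \<open>insert q C\<close> for \<open>k\<close> different \<open>q\<close>, and any two of these sets meet in \<open>C\<close>.
\<close>

lemma staged_shrink:
  assumes k: "(k, threshold_op A c k i) \<in> F" "k \<ge> 2" and i: "i \<notin> S"
    and base: "\<And>Y. Y \<subseteq> {..<N} \<Longrightarrow> card Y = M \<Longrightarrow> \<exists>t. staged A F c N S (\<lambda>_. Y) t"
    and X: "X \<subseteq> {..<N}" "card X = M + (k - 1)"
    and "C \<subseteq> X" "card C \<le> M"
  shows "\<exists>t. staged A F c N S (\<lambda>j. if j \<in> insert i S then C else X) t"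
  using assms(7,8)
proof (induction "M - card C" arbitrary: C)
  case 0
  \<comment> \<open>At full size \<open>M\<close> the term for the colours in \<open>S\<close> alone
    does the job, even with \<open>C\<close> for every colour.\<close>
  then obtain t where "staged A F c N S (\<lambda>_. C) t"
    using base[of C] X(1) by auto
  then have "staged A F c N S (\<lambda>j. if j \<in> insert i S then C else X) t"
    by (rule staged_mono) (use 0(2) in auto)
  then show ?case
    by blast
next
  case (Suc d)
  have finX: "finite X"
    using X(1) finite_subset by blast
  then have finC: "finite C"
    using Suc.prems(1) finite_subset by blast
  \<comment> \<open>Since \<open>card C < M\<close>, the size \<open>M + (k - 1)\<close> of
    \<open>X\<close> leaves just enough elements for \<open>k\<close> different
    \<open>q\<close>.\<close>
  have "k \<le> card (X - C)"
    using Suc X(2) k(2) card_Diff_subset[OF finC Suc.prems(1)] by simp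
  then obtain D where D: "D \<subseteq> X - C" "card D = k" "finite D"
    using obtain_subset_with_card_n by metis
  then obtain qs where qs: "set qs = D" "distinct qs"
    using finite_distinct_list by blast
  then have len: "length qs = k"
    using distinct_card[OF qs(2)] qs(1) D(2) by simp
  have "\<exists>t. staged A F c N S (\<lambda>j. if j \<in> insert i S then insert q C else X) t" if "q \<in> D" for q
  proof (rule Suc.hyps(1))
    have "card (insert q C) = Suc (card C)"
      using finC that D(1) by (intro card_insert_disjoint) auto
    then show "d = M - card (insert q C)" "card (insert q C) \<le> M"
      using Suc.hyps(2) by auto
    show "insert q C \<subseteq> X"
      using that D(1) Suc.prems(1) by blast
  qed
  then obtain T where T: "\<And>q. q \<in> D \<Longrightarrow>
      staged A F c N S (\<lambda>j. if j \<in> insert i S then insert q C else X) (T q)"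
    by metis
  define gs where "gs = map T qs"
  have lgs: "length gs = k"
    using len by (simp add: gs_def)
  have terms: "term_op A F N g" if "g \<in> set gs" for g
    using that qs(1) T by (auto simp: gs_def staged_def)
  have cons: "\<forall>g\<in>set gs. \<forall>z\<in>nlists N A. g z \<in> set z"
    using term_op_conservative[OF _ conservative] terms by blast
  let ?t = "compose_op A N (threshold_op A c k i) gs"
  have nth: "gs ! p = T (qs ! p)" "qs ! p \<in> D" if "p < k" for p
    using that len qs(1) nth_mem[of p qs] by (auto simp: gs_def)
  have diff: "qs ! p \<noteq> qs ! q" if "p < q" "q < k" for p q
    using that qs(2) len by (simp add: nth_eq_iff_index_eq)
  have "term_op A F N ?t"
    unfolding compose_op_def
    by (rule term_op.comp) (use terms term_op.basic[OF k(1)] lgs in auto)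
  moreover have "if c {a, b} \<in> S
     then deviations N ?t b a = {} \<and>
       deviations N ?t a b \<subseteq> (if c {a, b} \<in> insert i S then C else X)
     else deviations N ?t b a \<subseteq> (if c {a, b} \<in> insert i S then C else X) \<and>
       deviations N ?t a b = {}"
    if ab: "a \<in> A" "b \<in> A" "a < b" for a b
  proof (cases "c {a, b} = i")
    case True
    \<comment> \<open>Colour \<open>i\<close> is still untreated in the terms \<open>T q\<close>, so
      it deviates in one direction only.\<close>
    have T': "deviations N (T q) b a \<subseteq> insert q C" "deviations N (T q) a b = {}" if "q \<in> D" for q
      using stagedD(3)[OF T[OF that] ab] True i by auto
    have "deviations N ?t b a \<subseteq> C"
    proof
      fix j assume "j \<in> deviations N ?t b a"
      then obtain p q where pq: "p < q" "q < k"
        "j \<in> deviations N (gs ! p) b a" "j \<in> deviations N (gs ! q) b a"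
        using deviations_own_ba[OF lgs ab(3,1,2) cons, where c = c, OF True k(2)] by metis
      then have "j \<in> insert (qs ! p) C" "j \<in> insert (qs ! q) C"
        using nth[of p] nth[of q] T'(1)[of "qs ! p"] T'(1)[of "qs ! q"] by auto
      then show "j \<in> C"
        using diff[OF pq(1,2)] by auto
    qed
    moreover have "deviations N ?t a b = {}"
    proof (rule ccontr)
      assume "deviations N ?t a b \<noteq> {}"
      then obtain j where "j \<in> deviations N ?t a b"
        by blast
      then have "j \<in> deviations N (gs ! 0) a b \<or> j \<in> deviations N (gs ! 1) a b"
        using deviations_own_ab[OF lgs ab(3,1,2) cons, where c = c, OF True k(2), of j 0 1] k(2)
        by auto
      then show False
        using nth[of 0] nth[of 1] T'(2) k(2) by auto
    qed
    ultimately show ?thesis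
      using True i by simp
  next
    case False
    have "k \<ge> 1"
      using k(2) by simp
    have ba: "deviations N ?t b a \<subseteq> (\<Union>q\<in>D. deviations N (T q) b a)"
      using deviations_other_ba[OF lgs ab(3,1,2) cons, where c = c, OF False \<open>k \<ge> 1\<close>] qs(1)
      by (simp add: gs_def)
    have ab': "deviations N ?t a b \<subseteq> deviations N (T (qs ! p)) a b" if "p < k" for p
      using deviations_other_ab[OF lgs ab(3,1,2) cons, where c = c, OF False \<open>k \<ge> 1\<close>, of "gs ! p"]
        nth_mem[of p gs] that lgs nth(1)[OF that] by simp
    show ?thesis
    proof (cases "c {a, b} \<in> S")
      case S: True
      \<comment> \<open>For treated colours the deviations point the other way, and here the minimum
        intersects them.\<close>
      have T': "deviations N (T q) b a = {}" "deviations N (T q) a b \<subseteq> insert q C" if "q \<in> D" for q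
        using stagedD(2)[OF T[OF that] ab S] S by auto
      have "deviations N ?t a b \<subseteq> insert (qs ! 0) C" "deviations N ?t a b \<subseteq> insert (qs ! 1) C"
        using ab'[of 0] ab'[of 1] T'(2)[OF nth(2), of 0] T'(2)[OF nth(2), of 1] k(2) by auto
      then have "deviations N ?t a b \<subseteq> C"
        using diff[of 0 1] k(2) by auto
      moreover have "deviations N ?t b a = {}"
        using ba T'(1) by blast
      ultimately show ?thesis
        using S by simp
    next
      case S: False
      have T': "deviations N (T q) b a \<subseteq> X" "deviations N (T q) a b = {}" if "q \<in> D" for q
        using stagedD(3)[OF T[OF that] ab S] S False by auto
      have "deviations N ?t a b = {}"
        using ab'[of 0] T'(2)[OF nth(2)] k(2) by auto
      then show ?thesis
        using S False ba T'(1) by auto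
    qed
  qed
  ultimately show ?case
    unfolding staged_def by blast
qed

text \<open>The first claim feeds \<open>staged_shrink\<close> when the next colour is added; the
  second is the goal. A single colour of arity 2 is excluded from the second because
  \<open>staged_singleton\<close> empties only one direction there.\<close>

lemma staged_all:
  assumes "finite S" "S \<noteq> {}"
    and "\<And>i. i \<in> S \<Longrightarrow> (m i, threshold_op A c (m i) i) \<in> F" "\<And>i. i \<in> S \<Longrightarrow> m i \<ge> 2"
    and "X \<subseteq> {..<N}" "card X = 1 + (\<Sum>i\<in>S. m i - 1)"
  shows "\<exists>t. staged A F c N S (\<lambda>_. X) t"
    and "card S \<ge> 2 \<or> (\<forall>i\<in>S. m i \<ge> 3) \<Longrightarrow>
      \<exists>t. staged A F c N S (\<lambda>j. if j \<in> S then {} else X) t"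
  using assms
proof (induction S arbitrary: X rule: finite_ne_induct)
  case (singleton i)
  {
    case 1
    then obtain t where "staged A F c N {i} (\<lambda>j. if j = i \<and> m i \<ge> 3 then {} else X) t"
      using staged_singleton[of "m i" i X] by auto
    then have "staged A F c N {i} (\<lambda>_. X) t"
      by (rule staged_mono) auto
    then show ?case
      by blast
  next
    case 2
    then have "\<exists>t. staged A F c N {i} (\<lambda>j. if j = i \<and> m i \<ge> 3 then {} else X) t"
      by (intro staged_singleton) auto
    then show ?case
      using 2 by simp
  }
next
  case (insert i S)
  have *: "\<exists>t. staged A F c N (insert i S) (\<lambda>j. if j \<in> insert i S then {} else X) t"
    if F: "\<And>j. j \<in> insert i S \<Longrightarrow> (m j, threshold_op A c (m j) j) \<in> F"
      and m: "\<And>j. j \<in> insert i S \<Longrightarrow> m j \<ge> 2"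
      and X: "X \<subseteq> {..<N}" "card X = 1 + (\<Sum>i\<in>insert i S. m i - 1)" for X
  proof -
    have "\<exists>t. staged A F c N S (\<lambda>j. if j \<in> insert i S then {} else X) t"
    \<comment> \<open>Shrinking goes all the way to \<open>C = {}\<close>, for the old colours and
      the new one together.\<close>
    proof (rule staged_shrink[where k = "m i" and M = "1 + (\<Sum>i\<in>S. m i - 1)"])
      show "\<exists>t. staged A F c N S (\<lambda>_. Y) t"
        if "Y \<subseteq> {..<N}" "card Y = 1 + (\<Sum>i\<in>S. m i - 1)" for Y
        using that F m by (intro insert.IH(1)) auto
    qed (use F m X insert.hyps in auto)
    then obtain t where t: "staged A F c N S (\<lambda>j. if j \<in> insert i S then {} else X) t"
      by blast
    \<comment> \<open>For colour \<open>i\<close> both directions are now empty, so it may be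
      counted as treated.\<close>
    have "staged A F c N (insert i S) (\<lambda>j. if j \<in> insert i S then {} else X) t"
    proof (rule stagedI[OF stagedD(1)[OF t]])
      fix a b assume ab: "a \<in> A" "b \<in> A" "a < b"
      note D = stagedD(2,3)[OF t ab]
      show "deviations N t b a = {} \<and>
          deviations N t a b \<subseteq> (if c {a, b} \<in> insert i S then {} else X)"
        if "c {a, b} \<in> insert i S"
        using that D by (cases "c {a, b} \<in> S") simp_all
      show "deviations N t b a \<subseteq> (if c {a, b} \<in> insert i S then {} else X) \<and>
          deviations N t a b = {}"
        if "c {a, b} \<notin> insert i S"
        using that D(2) by simp
    qed
    then show ?thesis
      by blast
  qed
  {
    case 1
    then obtain t where "staged A F c N (insert i S) (\<lambda>j. if j \<in> insert i S then {} else X) t"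
      using *[of X] by auto
    then have "staged A F c N (insert i S) (\<lambda>_. X) t"
      by (rule staged_mono) auto
    then show ?case
      by blast
  next
    case 2
    then show ?case
      by (intro *) auto
  }
qed

end

text \<open>\<open>L\<close> indexes all operations and \<open>K\<close> the colours in use;
  operations with index outside \<open>K\<close> are minima on tuples over \<open>A\<close>, since
  \<open>c\<close> takes values in \<open>K\<close> on pairs.\<close>

lemma threshold_cube_term:
  fixes A :: "'a::linorder set" and c :: "'a set \<Rightarrow> 'c"
  assumes L: "\<And>i. i \<in> L \<Longrightarrow> m i \<ge> 1"
    and K: "finite K" "K \<noteq> {}" "K \<subseteq> L" "\<And>i. i \<in> K \<Longrightarrow> m i \<ge> 2"
    and c: "\<And>a b. a \<in> A \<Longrightarrow> b \<in> A \<Longrightarrow> a < b \<Longrightarrow> c {a, b} \<in> K"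
    and big: "card K \<ge> 2 \<or> (\<forall>i\<in>K. m i \<ge> 3)"
  shows "has_cube_term A {(m i, threshold_op A c (m i) i) | i. i \<in> L} (1 + (\<Sum>i\<in>K. m i - 1))"
    (is "has_cube_term A ?F ?N")
proof -
  have "f z \<in> set z" if f: "(k, f) \<in> ?F" "z \<in> nlists k A" for k f z
  proof -
    obtain i where i: "i \<in> L" "k = m i" "f = threshold_op A c k i"
      using f(1) by blast
    show ?thesis
      using threshold_op_mem[OF f(2), of c i] L[OF i(1)] i(2,3) by simp
  qed
  then have cons: "conservative A ?F"
    unfolding conservative_def by blast
  have "\<exists>t. staged A ?F c ?N K (\<lambda>j. if j \<in> K then {} else {..<?N}) t"
    by (rule staged_all(2)[OF cons, where m = m]) (use K big in auto)
  then obtain t where t: "staged A ?F c ?N K (\<lambda>j. if j \<in> K then {} else {..<?N}) t"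
    by blast
  then have T: "term_op A ?F ?N t"
    by (simp add: staged_def)
  show ?thesis
  proof (rule near_unanimity_imp_cube_term[OF T])
    fix x y assume xy: "x \<in> A" "y \<in> A"
    have less: "deviations ?N t a b = {} \<and> deviations ?N t b a = {}"
      if "a \<in> A" "b \<in> A" "a < b" for a b
      using stagedD(2)[OF t that c[OF that]] c[OF that] by simp
    show "deviations ?N t x y = {}"
    proof (cases x y rule: linorder_cases)
      case equal
      have "t (replicate ?N x) \<in> set (replicate ?N x)"
        by (rule term_op_conservative[OF T cons]) (use xy in \<open>auto simp: nlists_iff\<close>)
      then have "t (replicate ?N x) = x"
        unfolding set_replicate_conv_if by (simp only: singleton_iff split: if_splits)
      then show ?thesis
        unfolding equal[symmetric] by (rule deviations_same)
    qed (use less xy in auto)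
  qed
qed

text \<open>Pigeonhole: if operation \<open>i\<close> produced the removed tuple \<open>b\<close>,
  each of its \<open>m i\<close> arguments would have an entry \<open>a j\<close> at a coordinate of
  colour \<open>i\<close>, and no two could share one. There are at most \<open>m i - 1\<close> such
  coordinates.\<close>

lemma threshold_no_cube_term:
  fixes A :: "'a::linorder set" and c :: "'a set \<Rightarrow> 'c"
  assumes L: "\<And>i. i \<in> L \<Longrightarrow> m i \<ge> 1"
    and K: "finite K" "\<And>i. i \<in> K \<Longrightarrow> m i \<ge> 2"
    and c: "\<And>i. i \<in> K \<Longrightarrow> \<exists>a\<in>A. \<exists>b\<in>A. a < b \<and> c {a, b} = i"
  shows "\<not> has_cube_term A {(m i, threshold_op A c (m i) i) | i. i \<in> L} (\<Sum>i\<in>K. m i - 1)"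
    (is "\<not> has_cube_term A ?F ?d")
proof -
  \<comment> \<open>A coordinate is a colour together with a copy number; \<open>h\<close>
    enumerates them and \<open>g\<close> reads off the colour.\<close>
  let ?P = "SIGMA i:K. {..<m i - 1}"
  have "card ?P = ?d"
    using K(1) by simp
  moreover have "finite ?P"
    using K(1) by simp
  ultimately obtain h where h: "bij_betw h {..<?d} ?P"
    using ex_bij_betw_nat_finite[of ?P] by (auto simp: atLeast0LessThan)
  define g where "g j = fst (h j)" for j
  have g: "g j \<in> K" if "j < ?d" for j
    using bij_betwE[OF h] that by (force simp: g_def)
  have fibre: "card {j. j < ?d \<and> g j = i} \<le> m i - 1" for i
  proof -
    have "inj_on h {j. j < ?d \<and> g j = i}"
      using bij_betw_imp_inj_on[OF h] by (rule inj_on_subset) auto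
    moreover have "h ` {j. j < ?d \<and> g j = i} \<subseteq> {i} \<times> {..<m i - 1}"
      using bij_betwE[OF h] by (force simp: g_def)
    ultimately show ?thesis
      using card_inj_on_le[of h _ "{i} \<times> {..<m i - 1}"] by simp
  qed
  obtain a' b' where ab': "\<And>i. i \<in> K \<Longrightarrow> a' i \<in> A \<and> b' i \<in> A \<and> a' i < b' i \<and> c {a' i, b' i} = i"
    using c by metis
  define a where "a j = a' (g j)" for j
  define b where "b j = b' (g j)" for j
  have ab: "a j \<in> A" "b j \<in> A" "a j < b j" "c {a j, b j} = g j" if "j < ?d" for j
    using ab' g[OF that] by (auto simp: a_def b_def)
  show ?thesis
  proof (rule no_cube_term_if_cross[of ?d a A b])
    show "a j \<noteq> b j" if "j < ?d" for j
      using ab(3)[OF that] by simp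
    fix k f X
    assume "(k, f) \<in> ?F" and X: "\<And>p. p < k \<Longrightarrow> cross ?d a b (X p)"
    then obtain i where i: "i \<in> L" "k = m i" "f = threshold_op A c k i"
      by blast
    then have k: "k \<ge> 1"
      using L by simp
    let ?z = "\<lambda>j. map (\<lambda>p. X p j) [0..<k]"
    have sub: "set (?z j) \<subseteq> {a j, b j}" if "j < ?d" for j
    proof -
      have "\<forall>p<k. X p j = a j \<or> X p j = b j"
        using X that by (simp add: cross_def)
      then show ?thesis
        by auto
    qed
    then have z: "?z j \<in> nlists k A" if "j < ?d" for j
      using that ab(1,2)[OF that] by (fastforce simp: nlists_iff)
    have val: "f (?z j) \<in> {a j, b j}" if "j < ?d" for j
      using threshold_op_mem[OF z[OF that] k, of c i] sub[OF that] i(3) by blast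
    have "\<exists>j<?d. f (?z j) = a j"
    proof (rule ccontr)
      assume no: "\<not> (\<exists>j<?d. f (?z j) = a j)"
      have other: "a j \<notin> set (?z j)" if "j < ?d" "g j \<noteq> i" for j
        using threshold_op_other[OF z sub k, where c = c, of j i] ab that no i(3) by auto
      have own: "\<not> twice (a j) (?z j)" if "j < ?d" "g j = i" for j
        using threshold_op_own[OF z sub, where c = c, of j i] ab that no i(2,3) K(2)[of i] g by auto
      have "\<exists>j<?d. g j = i \<and> X p j = a j" if "p < k" for p
      proof -
        obtain j where "j < ?d" "X p j = a j"
          using X[OF \<open>p < k\<close>] by (auto simp: cross_def)
        moreover from this have "a j \<in> set (?z j)"
          using that by (auto intro!: image_eqI[of _ _ p])
        ultimately show ?thesis
          using other[of j] by blast
      qed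
      \<comment> \<open>\<open>\<phi> p\<close> is a coordinate of colour \<open>i\<close> at which
        argument \<open>p\<close> equals \<open>a\<close>.\<close>
      then obtain \<phi> where \<phi>: "\<And>p. p < k \<Longrightarrow> \<phi> p < ?d \<and> g (\<phi> p) = i \<and> X p (\<phi> p) = a (\<phi> p)"
        by metis
      have "inj_on \<phi> {..<k}"
      proof (rule linorder_inj_onI)
        fix p q assume pq: "p < q" "p \<in> {..<k}" "q \<in> {..<k}"
        show "\<phi> p \<noteq> \<phi> q"
        proof
          assume "\<phi> p = \<phi> q"
          then have "twice (a (\<phi> q)) (?z (\<phi> q))"
            using pq \<phi>[of p] \<phi>[of q] by (intro twiceI[of p q]) auto
          then show False
            using own \<phi> pq by auto
        qed
      qed auto
      moreover have "\<phi> ` {..<k} \<subseteq> {j. j < ?d \<and> g j = i}"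
        using \<phi> by auto
      ultimately have "k \<le> card {j. j < ?d \<and> g j = i}"
        using card_inj_on_le[of \<phi> "{..<k}"] by simp
      then show False
        using fibre[of i] i(2) k by simp
    qed
    then show "cross ?d a b (\<lambda>j. f (?z j))"
      using val by (auto simp: cross_def)
  qed (use ab in auto)
qed

section \<open>Idempotent quasigroups\<close>

text \<open>Extended by the identity outside \<open>S\<close>, the map is a permutation of finite
  order \<open>n\<close>, and \<open>k = n - 1\<close>.\<close>

lemma finite_inj_funpow_inverse:
  assumes "finite S" "\<phi> ` S \<subseteq> S" "inj_on \<phi> S"
  shows "\<exists>k. \<forall>x\<in>S. \<phi> ((\<phi> ^^ k) x) = x"
proof -
  define p where "p x = (if x \<in> S then \<phi> x else x)" for x
  have "bij_betw \<phi> S S"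
    using assms endo_inj_surj by (simp add: bij_betw_def)
  then have "bij_betw p S S"
    by (subst bij_betw_cong[of S p \<phi>]) (auto simp: p_def)
  then have "p permutes S"
    by (rule bij_imp_permutes) (simp add: p_def)
  then have "permutation p"
    using assms(1) permutation_permutes by blast
  then obtain n where n: "p ^^ n = id" "n > 0"
    by (rule permutation_is_nilpotent)
  then obtain k where k: "n = Suc k"
    using gr0_implies_Suc by blast
  have "(p ^^ j) x = (\<phi> ^^ j) x \<and> (\<phi> ^^ j) x \<in> S" if "x \<in> S" for j x
    using that assms(2) by (induction j) (auto simp: p_def)
  then have "\<phi> ((\<phi> ^^ k) x) = (p ^^ n) x" if "x \<in> S" for x
    using that by (simp add: k p_def)
  then show ?thesis
    using n(1) by auto
qed

text \<open>One exponent must serve all \<open>x\<close> for division to be a term. Hence all left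
  translations are combined into one injection of \<open>A \<times> A\<close>.\<close>

lemma uniform_left_division:
  assumes A: "finite A"
    and closed: "\<And>x y. x \<in> A \<Longrightarrow> y \<in> A \<Longrightarrow> f x y \<in> A"
    and cancel: "\<And>x y y'. x \<in> A \<Longrightarrow> y \<in> A \<Longrightarrow> y' \<in> A \<Longrightarrow> f x y = f x y' \<Longrightarrow> y = y'"
  shows "\<exists>k. \<forall>x\<in>A. \<forall>y\<in>A. f x ((f x ^^ k) y) = y"
proof -
  define \<phi> where "\<phi> = (\<lambda>(x, y). (x, f x y))"
  have "inj_on \<phi> (A \<times> A)"
    unfolding \<phi>_def by (rule inj_onI) (auto dest: cancel)
  moreover have "finite (A \<times> A)" "\<phi> ` (A \<times> A) \<subseteq> A \<times> A"
    using A by (auto simp: \<phi>_def closed)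
  ultimately obtain k where k: "\<forall>p\<in>A \<times> A. \<phi> ((\<phi> ^^ k) p) = p"
    using finite_inj_funpow_inverse by metis
  have "(\<phi> ^^ j) (x, y) = (x, (f x ^^ j) y)" for j x y
    by (induction j) (auto simp: \<phi>_def)
  then have "\<phi> ((\<phi> ^^ k) (x, y)) = (x, f x ((f x ^^ k) y))" for x y
    by (simp add: \<phi>_def)
  then show ?thesis
    using k by (metis SigmaI prod.inject)
qed

text \<open>This lets terms be composed as plain functions; the closure clause keeps inner values
  where the outer operation is defined.\<close>

definition realised_by ::
  "'a set \<Rightarrow> (nat \<times> ('a list \<Rightarrow> 'a)) set \<Rightarrow> nat \<Rightarrow> ('a list \<Rightarrow> 'a) \<Rightarrow> bool" where
  "realised_by A F k g \<longleftrightarrow> (\<forall>xs\<in>nlists k A. g xs \<in> A) \<and> term_op A F k (restrict g (nlists k A))"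

lemma realised_by_nth: "i < k \<Longrightarrow> realised_by A F k (\<lambda>xs. xs ! i)"
  using term_op.proj by (fastforce simp: realised_by_def nlists_iff)

lemma realised_by_binary:
  assumes F: "(2, \<lambda>z\<in>nlists 2 A. f (z ! 0) (z ! 1)) \<in> F"
    and closed: "\<And>x y. x \<in> A \<Longrightarrow> y \<in> A \<Longrightarrow> f x y \<in> A"
    and g: "realised_by A F k g" and h: "realised_by A F k h"
  shows "realised_by A F k (\<lambda>xs. f (g xs) (h xs))"
proof -
  let ?gs = "[restrict g (nlists k A), restrict h (nlists k A)]"
  have "term_op A F k (\<lambda>xs\<in>nlists k A. (\<lambda>z\<in>nlists 2 A. f (z ! 0) (z ! 1)) (map (\<lambda>g. g xs) ?gs))"
  proof (rule term_op.comp)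
    have len: "length ?gs = 2"
      by simp
    show "term_op A F (length ?gs) (\<lambda>z\<in>nlists 2 A. f (z ! 0) (z ! 1))"
      unfolding len by (rule term_op.basic[OF F])
    show "\<forall>g\<in>set ?gs. term_op A F k g"
      using g h unfolding realised_by_def by simp
  qed
  also have "(\<lambda>xs\<in>nlists k A. (\<lambda>z\<in>nlists 2 A. f (z ! 0) (z ! 1)) (map (\<lambda>g. g xs) ?gs))
      = restrict (\<lambda>xs. f (g xs) (h xs)) (nlists k A)"
    by (rule restrict_ext) (use g h in \<open>auto simp: realised_by_def nlists_iff\<close>)
  finally show ?thesis
    using g h closed unfolding realised_by_def by blast
qed

text \<open>
  The term is \<open>(x / z) (z \ y)\<close>; finiteness makes both divisions iterated multiplications.
\<close>

lemma quasigroup_cube_term: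
  assumes F: "(2, \<lambda>z\<in>nlists 2 A. f (z ! 0) (z ! 1)) \<in> F"
    and A: "finite A"
    and closed: "\<And>x y. x \<in> A \<Longrightarrow> y \<in> A \<Longrightarrow> f x y \<in> A"
    and idem: "\<And>x. x \<in> A \<Longrightarrow> f x x = x"
    and left: "\<And>x y y'. x \<in> A \<Longrightarrow> y \<in> A \<Longrightarrow> y' \<in> A \<Longrightarrow> f x y = f x y' \<Longrightarrow> y = y'"
    and right: "\<And>x x' y. x \<in> A \<Longrightarrow> x' \<in> A \<Longrightarrow> y \<in> A \<Longrightarrow> f x y = f x' y \<Longrightarrow> x = x'"
  shows "has_cube_term A F 2"
proof -
  \<comment> \<open>Right translations, with the fixed factor first, so that
    \<open>uniform_left_division\<close> also gives right division.\<close>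
  define fr where "fr z x = f x z" for z x
  obtain k where k: "\<And>x y. x \<in> A \<Longrightarrow> y \<in> A \<Longrightarrow> f x ((f x ^^ k) y) = y"
    using uniform_left_division[of A f] A closed left by metis
  obtain l where l: "\<And>x z. x \<in> A \<Longrightarrow> z \<in> A \<Longrightarrow> fr z ((fr z ^^ l) x) = x"
    using uniform_left_division[of A fr] A closed right unfolding fr_def by metis
  have fix1: "(f x ^^ j) x = x" and fix2: "(fr x ^^ j) x = x" if "x \<in> A" for x j
    using that idem by (induction j) (auto simp: fr_def)
  note bin = realised_by_binary[OF F closed]
  have pow1: "realised_by A F 3 (\<lambda>xs. (f (xs ! 2) ^^ j) (xs ! 1))" for j
    by (induction j) (auto intro!: realised_by_nth bin)
  have pow2: "realised_by A F 3 (\<lambda>xs. (fr (xs ! 2) ^^ j) (xs ! 0))" for j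
    by (induction j) (auto simp: fr_def intro!: realised_by_nth bin)
  define g where "g xs = f ((fr (xs ! 2) ^^ l) (xs ! 0)) ((f (xs ! 2) ^^ k) (xs ! 1))" for xs
  define t where "t = restrict g (nlists 3 A)"
  have "realised_by A F 3 g"
    unfolding g_def by (rule bin[OF _ _ pow2 pow1])
  then have "term_op A F (2 ^ 2 - 1) t"
    by (simp add: realised_by_def t_def)
  moreover define Is where "Is = [{0}, {1}, {0, 1::nat}]"
  have "distinct Is"
    by (auto simp: Is_def)
  moreover have "set Is = Pow {..<2} - {{}}"
    by (auto simp: Is_def numeral_2_eq_2 lessThan_Suc Pow_insert)
  then have "set Is = {I. I \<subseteq> {..<2} \<and> I \<noteq> {}}"
    by auto
  moreover have "t (map (\<lambda>I. chi I a b ! i) Is) = a ! i"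
    if a: "a \<in> nlists 2 A" and b: "b \<in> nlists 2 A" and i: "i < 2" for a b i
  proof -
    have len: "length a = 2" "length b = 2"
      using a b by (auto simp: nlists_iff)
    then have mem: "a ! 0 \<in> A" "a ! 1 \<in> A" "b ! 0 \<in> A" "b ! 1 \<in> A"
      using a b nth_mem unfolding nlists_iff by auto
    have chi: "chi I a b ! i = (if i \<in> I then b ! i else a ! i)" for I
      using i len by (simp add: chi_def)
    have t: "t [x, y, z] = f ((fr z ^^ l) x) ((f z ^^ k) y)" if "x \<in> A" "y \<in> A" "z \<in> A" for x y z
      using that by (simp add: t_def g_def nlists_iff)
    have eq: "map (\<lambda>I. chi I a b ! i) Is
        = [if i = 0 then b ! i else a ! i, if i = 1 then b ! i else a ! i, b ! i]"
      using i by (auto simp: Is_def chi)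
    consider "i = 0" | "i = 1"
      using i by linarith
    then show ?thesis
      unfolding eq using mem k l fix1 fix2 by cases (simp_all add: t fr_def)
  qed
  ultimately show ?thesis
    unfolding has_cube_term_def is_cube_term_def by blast
qed

section \<open>Construction of idempotent latin squares\<close>

lemma double_diff_mod_cancel_left:
  fixes M :: int
  assumes "odd M" "(2 * y - x) mod M = (2 * y' - x) mod M"
  shows "y mod M = y' mod M"
proof -
  have "M dvd 2 * (y - y')"
    using assms(2) by (simp add: mod_eq_dvd_iff algebra_simps)
  moreover have "coprime M 2"
    using assms(1) by simp
  ultimately have "M dvd y - y'"
    using coprime_dvd_mult_right_iff by blast
  then show ?thesis
    by (simp add: mod_eq_dvd_iff)
qed

lemma double_diff_mod_cancel_right:
  fixes M :: int
  assumes "(2 * y - x) mod M = (2 * y - x') mod M"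
  shows "x mod M = x' mod M"
  using assms by (simp add: mod_eq_dvd_iff dvd_diff_commute)

lemma add_mod_cancel_right:
  fixes M :: int
  assumes "(x + d) mod M = (x' + d) mod M"
  shows "x mod M = x' mod M"
  using assms by (simp add: mod_eq_dvd_iff)

definition idempotent_latin_square :: "'a set \<Rightarrow> ('a \<Rightarrow> 'a \<Rightarrow> 'a) \<Rightarrow> bool" where
  "idempotent_latin_square A f \<longleftrightarrow>
    (\<forall>x\<in>A. f x x = x \<and> f x ` A \<subseteq> A \<and> inj_on (f x) A \<and> inj_on (\<lambda>y. f y x) A)"

text \<open>The entry is the reflection of \<open>x\<close> in \<open>y\<close> modulo
  \<open>M\<close>. Columns are always injective; rows are because 2 is invertible modulo an odd
  \<open>M\<close>.\<close>

lemma idempotent_latin_square_odd: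
  fixes M :: int
  assumes "odd M" "M > 0"
  shows "idempotent_latin_square {0..<M} (\<lambda>x y. (2 * y - x) mod M)"
  unfolding idempotent_latin_square_def
proof (intro ballI conjI)
  fix x assume x: "x \<in> {0..<M}"
  show "(2 * x - x) mod M = x"
    using x by simp
  show "(\<lambda>y. (2 * y - x) mod M) ` {0..<M} \<subseteq> {0..<M}"
    using assms(2) by auto
  show "inj_on (\<lambda>y. (2 * y - x) mod M) {0..<M}"
    by (rule inj_onI, drule double_diff_mod_cancel_left[OF assms(1)]) simp
  show "inj_on (\<lambda>y. (2 * x - y) mod M) {0..<M}"
    by (rule inj_onI, drule double_diff_mod_cancel_right) simp
qed

text \<open>
  For even order, prolong the previous square: the cells \<open>(x, x + 1)\<close> form a transversal, with
  entries \<open>x + 2\<close>; it is moved to a new row and a new column, both indexed by \<open>M\<close>, and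
  replaced by the new symbol \<open>M\<close>.
\<close>

definition prolongation :: "int \<Rightarrow> int \<Rightarrow> int \<Rightarrow> int" where
  "prolongation M x y =
    (if x = M then if y = M then M else (y + 1) mod M
     else if y = M then (x + 2) mod M
     else if y = (x + 1) mod M then M
     else (2 * y - x) mod M)"

text \<open>A moved entry could clash only with the cell it vacated. The transversal misses the
  diagonal because \<open>M > 1\<close>, so idempotence survives.\<close>

lemma idempotent_latin_square_even:
  fixes M :: int
  assumes M: "odd M" "M > 1"
  shows "idempotent_latin_square {0..M} (prolongation M)"
proof -
  have less: "z mod M \<noteq> M" "M \<noteq> z mod M" for z
    using M(2) pos_mod_bound[of M z] by linarith+
  have small: "z mod M = z" if "z \<in> {0..M}" "z \<noteq> M" for z
    by (rule mod_pos_pos_trivial) (use that in auto)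
  have left: "y = y'"
    if mem: "x \<in> {0..M}" "y \<in> {0..M}" "y' \<in> {0..M}"
      and eq: "prolongation M x y = prolongation M x y'" for x y y'
  proof (cases "x = M")
    case True
    then show ?thesis
      using eq less small[OF mem(2)] small[OF mem(3)] add_mod_cancel_right[of y 1 M y']
      unfolding prolongation_def by (metis (no_types))
  next
    case x: False
    \<comment> \<open>The moved entry \<open>x + 2\<close> equals \<open>2 * z - x\<close> modulo
      \<open>M\<close> only at the vacated cell \<open>z = x + 1\<close>.\<close>
    have new: False
      if "z \<in> {0..M}" "z \<noteq> M" "z \<noteq> (x + 1) mod M" "(x + 2) mod M = (2 * z - x) mod M" for z
      using double_diff_mod_cancel_left[OF M(1), of "x + 1" x z] that small[of z]
      by (simp add: algebra_simps)
    show ?thesis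
      using eq x less mem new[of y] new[of y'] small[OF mem(2)] small[OF mem(3)]
        double_diff_mod_cancel_left[OF M(1), of y x y']
      unfolding prolongation_def by (metis (no_types))
  qed
  have right: "x = x'"
    if mem: "y \<in> {0..M}" "x \<in> {0..M}" "x' \<in> {0..M}"
      and eq: "prolongation M x y = prolongation M x' y" for x x' y
  proof (cases "y = M")
    case True
    then show ?thesis
      using eq less small[OF mem(2)] small[OF mem(3)] add_mod_cancel_right[of x 2 M x']
      unfolding prolongation_def by (metis (no_types))
  next
    case y: False
    \<comment> \<open>In column \<open>y\<close> the moved entry is \<open>y + 1\<close>, and the
      vacated cell lies in row \<open>y - 1\<close>.\<close>
    have new: False
      if z: "z \<in> {0..M}" "z \<noteq> M" "y \<noteq> (z + 1) mod M" "(y + 1) mod M = (2 * y - z) mod M" for z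
    proof -
      have "(y - 1) mod M = z mod M"
        by (rule double_diff_mod_cancel_right[of y]) (use z(4) in \<open>simp add: algebra_simps\<close>)
      then have "(y - 1 + 1) mod M = (z + 1) mod M"
        by (rule mod_add_cong) simp
      then show False
        using z(3) small[OF mem(1) y] by simp
    qed
    show ?thesis
      using eq y less mem new[of x] new[of x'] small[OF mem(2)] small[OF mem(3)]
        double_diff_mod_cancel_right[of y x M x'] add_mod_cancel_right[of x 1 M x']
      unfolding prolongation_def by (metis (no_types))
  qed
  have "prolongation M x x = x" if "x \<in> {0..M}" for x
  proof -
    have "x \<noteq> (x + 1) mod M" if "x \<noteq> M"
    proof
      assume "x = (x + 1) mod M"
      then have "x mod M = (x + 1) mod M"
        by (metis mod_mod_trivial)
      then have "M dvd 1"
        by (simp add: mod_eq_dvd_iff)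
      then show False
        using M(2) by auto
    qed
    then show ?thesis
      using that by (auto simp: prolongation_def)
  qed
  moreover have "prolongation M x y \<in> {0..M}" for x y
    using M(2) pos_mod_bound[of M] by (simp add: prolongation_def less_imp_le)
  ultimately show ?thesis
    unfolding idempotent_latin_square_def inj_on_def using left right by blast
qed

text \<open>The squares on integer residues are shifted by one to \<open>{1..n}\<close>. Order 2
  admits no such square.\<close>

lemma idempotent_latin_square_exists:
  fixes n :: nat
  assumes "n \<ge> 3"
  shows "\<exists>f. idempotent_latin_square {1..n} f"
proof -
  obtain f where f: "idempotent_latin_square {0..<int n} f"
  proof (cases "odd n")
    case True
    then show thesis
      using idempotent_latin_square_odd[of "int n"] assms that by auto
  next
    case False
    have "{0..int n - 1} = {0..<int n}"
      by auto
    then show thesis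
      using idempotent_latin_square_even[of "int n - 1"] False assms that by auto
  qed
  define g where "g x y = nat (f (int x - 1) (int y - 1)) + 1" for x y
  have mem: "int x - 1 \<in> {0..<int n}" if "x \<in> {1..n}" for x
    using that by auto
  have closed: "f x y \<in> {0..<int n}" if "x \<in> {0..<int n}" "y \<in> {0..<int n}" for x y
    using f that unfolding idempotent_latin_square_def by blast
  have "g x x = x \<and> g x ` {1..n} \<subseteq> {1..n} \<and> inj_on (g x) {1..n} \<and> inj_on (\<lambda>y. g y x) {1..n}"
    if x: "x \<in> {1..n}" for x
  proof (intro conjI)
    have "f (int x - 1) (int x - 1) = int x - 1"
      using f mem[OF x] unfolding idempotent_latin_square_def by blast
    then show "g x x = x"
      using x by (auto simp: g_def)
    show "g x ` {1..n} \<subseteq> {1..n}"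
      using closed[OF mem[OF x] mem] by (force simp: g_def)
    have inj: "inj_on (f (int x - 1)) {0..<int n}" "inj_on (\<lambda>y. f y (int x - 1)) {0..<int n}"
      using f mem[OF x] unfolding idempotent_latin_square_def by blast+
    show "inj_on (g x) {1..n}"
    proof (rule inj_onI)
      fix y z assume yz: "y \<in> {1..n}" "z \<in> {1..n}" "g x y = g x z"
      then have "f (int x - 1) (int y - 1) = f (int x - 1) (int z - 1)"
        using closed[OF mem[OF x] mem[OF yz(1)]] closed[OF mem[OF x] mem[OF yz(2)]]
        by (simp add: g_def eq_nat_nat_iff)
      then show "y = z"
        using inj_onD[OF inj(1) _ mem[OF yz(1)] mem[OF yz(2)]] by simp
    qed
    show "inj_on (\<lambda>y. g y x) {1..n}"
    proof (rule inj_onI)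
      fix y z assume yz: "y \<in> {1..n}" "z \<in> {1..n}" "g y x = g z x"
      then have "f (int y - 1) (int x - 1) = f (int z - 1) (int x - 1)"
        using closed[OF mem[OF yz(1)] mem[OF x]] closed[OF mem[OF yz(2)] mem[OF x]]
        by (simp add: g_def eq_nat_nat_iff)
      then show "y = z"
        using inj_onD[OF inj(2) _ mem[OF yz(1)] mem[OF yz(2)]] by simp
    qed
  qed
  then show ?thesis
    unfolding idempotent_latin_square_def by blast
qed

section \<open>Attaining the bound\<close>

lemma threshold_op_operations:
  assumes "k \<ge> 1"
  shows "threshold_op A c k i \<in> operations A k" and "idempotent_op A k (threshold_op A c k i)"
proof -
  have "threshold_op A c k i z \<in> A" if "z \<in> nlists k A" for z
    using threshold_op_mem[OF that assms, of c i] nlistsE_set[OF that] by blast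
  then show "threshold_op A c k i \<in> operations A k"
    unfolding operations_def by (rule PiE_I) (simp_all add: threshold_op_def)
  have "threshold_op A c k i (replicate k a) = a" if "a \<in> A" for a
  proof -
    have "replicate k a \<in> nlists k A"
      using that by (auto simp: nlists_iff)
    from threshold_op_mem[OF this assms, of c i] show ?thesis
      by simp
  qed
  then show "idempotent_op A k (threshold_op A c k i)"
    unfolding idempotent_op_def by blast
qed

lemma threshold_algebra_exists:
  fixes n :: nat and m :: "nat \<Rightarrow> nat"
  assumes L: "\<And>i. i \<in> L \<Longrightarrow> m i \<ge> 1"
    and K: "finite K" "K \<noteq> {}" "K \<subseteq> L" "\<And>i. i \<in> K \<Longrightarrow> m i \<ge> 2" "card K \<le> n choose 2"
    and big: "card K \<ge> 2 \<or> (\<forall>i\<in>K. m i \<ge> 3)"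
  shows "\<exists>f. (\<forall>i\<in>L. f i \<in> operations {1..n} (m i) \<and> idempotent_op {1..n} (m i) (f i)) \<and>
    has_cube_term {1..n} {(m i, f i) | i. i \<in> L} (1 + (\<Sum>i\<in>K. m i - 1)) \<and>
    \<not> has_cube_term {1..n} {(m i, f i) | i. i \<in> L} (\<Sum>i\<in>K. m i - 1)"
proof -
  define P where "P = {B. B \<subseteq> {1..n} \<and> card B = 2}"
  have "card P = n choose 2" "finite P"
    using n_subsets[of "{1..n}" 2] by (auto simp: P_def)
  then obtain h where "h ` K \<subseteq> P" "inj_on h K"
    using card_le_inj[of K P] K(1,5) by auto
  \<comment> \<open>An injection of the colours into the pairs yields a surjective colouring: every
    pair is coloured and every colour occurs.\<close>
  then obtain c where c: "c ` P = K"
    using inj_on_iff_surj[of K P] K(2) by auto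
  have "c {a, b} \<in> K" if "a \<in> {1..n}" "b \<in> {1..n}" "a < b" for a b
    using that c by (force simp: P_def)
  moreover have "\<exists>a\<in>{1..n}. \<exists>b\<in>{1..n}. a < b \<and> c {a, b} = i" if "i \<in> K" for i
  proof -
    obtain B where B: "B \<subseteq> {1..n}" "card B = 2" "c B = i"
      using \<open>i \<in> K\<close> c by (auto simp: P_def)
    then obtain a b where ab: "B = {a, b}" "a \<noteq> b"
      by (auto simp: card_2_iff)
    define a' b' where "a' = min a b" and "b' = max a b"
    have "B = {a', b'}" "a' < b'"
      using ab by (auto simp: a'_def b'_def min_def max_def)
    then show ?thesis
      using B by (intro bexI[of _ a'] bexI[of _ b']) auto
  qed
  ultimately have
    "has_cube_term {1..n} {(m i, threshold_op {1..n} c (m i) i) | i. i \<in> L} (1 + (\<Sum>i\<in>K. m i - 1))"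
    "\<not> has_cube_term {1..n} {(m i, threshold_op {1..n} c (m i) i) | i. i \<in> L} (\<Sum>i\<in>K. m i - 1)"
    using threshold_cube_term[where A = "{1..n}" and c = c, OF L K(1-4) _ big]
      threshold_no_cube_term[where A = "{1..n}" and c = c and L = L and m = m, OF L K(1,4)]
    by blast+
  then show ?thesis
    by (intro exI[of _ "\<lambda>i. threshold_op {1..n} c (m i) i"])
      (blast intro: threshold_op_operations L)
qed

lemma maltsev_algebra_exists:
  fixes n :: nat and m :: "nat \<Rightarrow> nat"
  assumes L: "\<And>i. i \<in> L \<Longrightarrow> m i \<ge> 1" and n: "n \<ge> 3" and k: "k \<in> L" "m k = 2"
  shows "\<exists>f. (\<forall>i\<in>L. f i \<in> operations {1..n} (m i) \<and> idempotent_op {1..n} (m i) (f i)) \<and>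
    has_cube_term {1..n} {(m i, f i) | i. i \<in> L} 2 \<and>
    \<not> has_cube_term {1..n} {(m i, f i) | i. i \<in> L} 1"
proof -
  obtain q where q: "idempotent_latin_square {1..n} q"
    using idempotent_latin_square_exists[OF n] by blast
  note Q = q[unfolded idempotent_latin_square_def]
  let ?A = "{1..n}"
  \<comment> \<open>The quasigroup alone supplies the Maltsev term; the other operations are first
    projections.\<close>
  define f where "f i = (if i = k then (\<lambda>z\<in>nlists 2 ?A. q (z ! 0) (z ! 1))
    else (\<lambda>z\<in>nlists (m i) ?A. z ! 0))" for i
  have "f i \<in> operations ?A (m i) \<and> idempotent_op ?A (m i) (f i)" if i: "i \<in> L" for i
  proof (cases "i = k")
    case True
    have "q (z ! 0) (z ! 1) \<in> ?A" if "z \<in> nlists 2 ?A" for z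
    proof -
      have "z ! 0 \<in> ?A" "z ! 1 \<in> ?A"
        using nlistsE_nth_in[OF that] by auto
      then show ?thesis
        using Q by blast
    qed
    moreover have "q (replicate 2 a ! 0) (replicate 2 a ! 1) = a" "replicate 2 a \<in> nlists 2 ?A"
      if "a \<in> ?A" for a
      using Q that by (auto simp: nlists_iff)
    ultimately show ?thesis
      using True k(2) by (simp add: f_def operations_def idempotent_op_def PiE_I)
  next
    case False
    have "z ! 0 \<in> ?A" if "z \<in> nlists (m i) ?A" for z
      using nlistsE_nth_in[OF that, of 0] L[OF i] by simp
    moreover have "replicate (m i) a ! 0 = a" "replicate (m i) a \<in> nlists (m i) ?A"
      if "a \<in> ?A" for a
      using L[OF i] that by (auto simp: nlists_iff)
    ultimately show ?thesis
      using False by (simp add: f_def operations_def idempotent_op_def PiE_I)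
  qed
  moreover have "has_cube_term ?A {(m i, f i) | i. i \<in> L} 2"
  proof (rule quasigroup_cube_term)
    show "(2, \<lambda>z\<in>nlists 2 ?A. q (z ! 0) (z ! 1)) \<in> {(m i, f i) | i. i \<in> L}"
      using k by (auto simp: f_def intro!: exI[of _ k])
    show "q x y \<in> ?A" if "x \<in> ?A" "y \<in> ?A" for x y
      using Q that by blast
    show "y = y'" if "x \<in> ?A" "y \<in> ?A" "y' \<in> ?A" "q x y = q x y'" for x y y'
      using Q that inj_onD[of "q x" ?A y y'] by blast
    show "x = x'" if "x \<in> ?A" "x' \<in> ?A" "y \<in> ?A" "q x y = q x' y" for x x' y
      using Q that inj_onD[of "\<lambda>x. q x y" ?A x x'] by blast
  qed (use Q in auto)
  moreover have "\<not> has_cube_term ?A {(m i, f i) | i. i \<in> L} 1"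
    by (rule no_cube_term_of_dimension_1[of 1 _ 2]) (use n in auto)
  ultimately show ?thesis
    by blast
qed

theorem theorem22:
  fixes l n r N :: nat and m :: "nat \<Rightarrow> nat"
  assumes "l \<ge> 1" and "n \<ge> 1"
    and "\<And>i. i \<in> {1..l} \<Longrightarrow> m i \<ge> 1"
    and "\<And>i j. 1 \<le> i \<Longrightarrow> i \<le> j \<Longrightarrow> j \<le> l \<Longrightarrow> m i \<ge> m j"
    and "r = min l (n choose 2)"
    and "N = 1 + (\<Sum>i = 1..r. (m i - 1))"
    and "n > 2 \<or> (n = 2 \<and> N > 2)"
    and "N > 1"
  shows "\<exists>f :: nat \<Rightarrow> nat list \<Rightarrow> nat.
    (\<forall>i\<in>{1..l}. f i \<in> operations {1..n} (m i) \<and> idempotent_op {1..n} (m i) (f i)) \<and>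
    has_cube_term {1..n} {(m i, f i) | i. i \<in> {1..l}} N \<and>
    \<not> has_cube_term {1..n} {(m i, f i) | i. i \<in> {1..l}} (N - 1)"
proof -
  \<comment> \<open>Unary operations add 0 to \<open>N\<close>, so only the larger arities serve as
    colours.\<close>
  define K where "K = {i \<in> {1..r}. m i \<ge> 2}"
  have K: "finite K" "K \<subseteq> {1..l}" "\<And>i. i \<in> K \<Longrightarrow> m i \<ge> 2"
    using assms(5) by (auto simp: K_def)
  have "card K \<le> card {1..r}"
    by (rule card_mono) (auto simp: K_def)
  then have cardK: "card K \<le> n choose 2"
    using assms(5) by simp
  have "(\<Sum>i = 1..r. m i - 1) = (\<Sum>i\<in>K. m i - 1)"
    by (rule sum.mono_neutral_right) (auto simp: K_def)
  then have N: "N = 1 + (\<Sum>i\<in>K. m i - 1)"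
    using assms(6) by simp
  then have ne: "K \<noteq> {}"
    using assms(8) by auto
  show ?thesis
  proof (cases "N > 2")
    case True
    \<comment> \<open>A single colour of arity 2 would give \<open>N = 2\<close>.\<close>
    have "card K \<ge> 2 \<or> (\<forall>i\<in>K. m i \<ge> 3)"
    proof (rule disjCI)
      assume small: "\<not> (\<forall>i\<in>K. m i \<ge> 3)"
      then obtain k where k: "k \<in> K" "m k = 2"
        using K(3) by (metis One_nat_def Suc_1 Suc_leI le_neq_implies_less numeral_3_eq_3)
      have "K \<noteq> {k}"
        using True N k(2) by auto
      then have "card K \<noteq> 1"
        using k(1) by (auto simp: card_1_singleton_iff)
      then show "card K \<ge> 2"
        using ne K(1) by (cases "card K") auto
    qed
    then show ?thesis
      using threshold_algebra_exists[where L = "{1..l}" and m = m, OF assms(3) K(1) ne K(2,3) cardK] N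
      by simp
  next
    case False
    obtain k where k: "k \<in> K"
      using ne by blast
    then have "m k - 1 \<le> (\<Sum>i\<in>K. m i - 1)"
      using K(1) by (intro member_le_sum) auto
    \<comment> \<open>Here the whole sum is at most 1, which bounds the summand
      \<open>m k - 1\<close>.\<close>
    then have "m k = 2"
      using False N K(3)[OF k] by simp
    moreover have "N = 2" "n \<ge> 3"
      using False assms(7,8) by auto
    ultimately show ?thesis
      using maltsev_algebra_exists[where L = "{1..l}" and m = m and n = n and k = k] assms(3) k K(2) by (simp add: subset_iff)
  qed
qed

end
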